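(* Let $t:\mathbb{Z}_{\geqslant 0}\to\{-1,1\}$ be the Thue--Morse sequence, defined by $t(0)=1$, $t(2k)=t(k)$ and $t(2k+1)=-t(k)$ for $k\geqslant 0$, and for $m\geqslant 0$ let \[\eta(m)=\lim_{N\to\infty}\frac{1}{N}\sum_{k=0}^{N-1}t(k)\,t(k+m)\] be its autocorrelation coefficients (these limits exist). There exist positive constants $c_1$ and $c_2$ such that for every real $x\geqslant 1$, \[c_1\,x^{0.6274882485}\leqslant \sum_{0\leqslant m\leqslant x}|\eta(m)|\leqslant c_2\,x^{0.6464616661},\] where the sum runs over integers $m$ with $0\leqslant m\leqslant x$.
   Context: Equivalently, $\eta$ is determined by $\eta(0)=1$ and, for $m\geqslant 0$, $\eta(2m)=\eta(m)$ and $\eta(2m+1)=-\tfrac12\big(\eta(m)+\eta(m+1)\big)$. *)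

theory Defs
  imports Complex_Main
begin

fun thue_morse :: "nat \<Rightarrow> int" where
  "thue_morse n =
     (if n = 0 then 1
      else if even n then thue_morse (n div 2)
      else - thue_morse (n div 2))"

declare thue_morse.simps [simp del]

lemma thue_morse_0: "thue_morse 0 = 1"
  by (simp add: thue_morse.simps)

lemma thue_morse_even: "thue_morse (2 * k) = thue_morse k"
  by (cases "k = 0") (simp_all add: thue_morse.simps [of "2 * k"] thue_morse_0)

lemma thue_morse_odd: "thue_morse (2 * k + 1) = - thue_morse k"
  by (simp add: thue_morse.simps [of "Suc (2 * k)"])

lemma thue_morse_range: "thue_morse n \<in> {-1, 1}"
  by (induction n rule: thue_morse.induct) (subst thue_morse.simps, auto)

definition thue_morse_corr_sum :: "nat \<Rightarrow> nat \<Rightarrow> real" where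
  "thue_morse_corr_sum m N = (\<Sum>k<N. of_int (thue_morse k * thue_morse (k + m)))"

definition eta :: "nat \<Rightarrow> real" where
  "eta m = lim (\<lambda>N. thue_morse_corr_sum m N / real N)"

text \<open>The rest of the theory shows that the limits defining \<open>eta\<close> exist, with error
  \<open>O (1 / sqrt N)\<close>, and that \<open>eta\<close> satisfies its usual recursion; so \<open>lim\<close> is
  never used on a divergent sequence.\<close>

lemma corr_sum_Suc: "\<bar>thue_morse_corr_sum m (Suc N) - thue_morse_corr_sum m N\<bar> = 1"
  using thue_morse_range[of N] thue_morse_range[of "N + m"]
  by (auto simp: thue_morse_corr_sum_def)

lemma corr_sum_double_even: "thue_morse_corr_sum (2 * m) (2 * N) = 2 * thue_morse_corr_sum m N"
proof (induction N)
  case (Suc N)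
  have "thue_morse (2 * N + 2 * m) = thue_morse (N + m)"
    using thue_morse_even[of "N + m"] by (simp add: algebra_simps)
  moreover have "thue_morse (Suc (2 * N + 2 * m)) = - thue_morse (N + m)"
    using thue_morse_odd[of "N + m"] by (simp add: algebra_simps)
  ultimately show ?case
    using Suc thue_morse_even[of N] thue_morse_odd[of N]
    by (simp add: thue_morse_corr_sum_def)
qed (simp add: thue_morse_corr_sum_def)

lemma corr_sum_double_odd:
  "thue_morse_corr_sum (2 * m + 1) (2 * N) =
     - (thue_morse_corr_sum m N + thue_morse_corr_sum (m + 1) N)"
proof (induction N)
  case (Suc N)
  have "thue_morse (Suc (2 * N + 2 * m)) = - thue_morse (N + m)"
    using thue_morse_odd[of "N + m"] by (simp add: algebra_simps)
  moreover have "thue_morse (Suc (Suc (2 * N + 2 * m))) = thue_morse (Suc (N + m))"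
    using thue_morse_even[of "N + m + 1"] by (simp add: algebra_simps)
  ultimately show ?case
    using Suc thue_morse_even[of N] thue_morse_odd[of N]
    by (simp add: thue_morse_corr_sum_def)
qed (simp add: thue_morse_corr_sum_def)

lemma corr_sum_0: "thue_morse_corr_sum 0 N = N"
proof -
  have "thue_morse k * thue_morse k = 1" for k
    using thue_morse_range[of k] by auto
  then show ?thesis by (simp add: thue_morse_corr_sum_def)
qed

lemma corr_sum_div2:
  "\<bar>thue_morse_corr_sum m N - thue_morse_corr_sum m (2 * (N div 2))\<bar> \<le> 1"
proof (cases "even N")
  case False
  then have "N = Suc (2 * (N div 2))" by presburger
  then show ?thesis using corr_sum_Suc[of m "2 * (N div 2)"] by simp
qed simp

definition corr_rate :: "nat \<Rightarrow> real \<Rightarrow> bool" where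
  "corr_rate m l \<longleftrightarrow> (\<exists>C\<ge>0. \<forall>N. \<bar>thue_morse_corr_sum m N - l * N\<bar> \<le> C * sqrt N)"

lemma corr_rate_from_even:
  assumes "C \<ge> 0" and C: "\<And>M. \<bar>thue_morse_corr_sum m (2 * M) - l * (2 * real M)\<bar> \<le> C * sqrt M"
  shows "corr_rate m l"
  unfolding corr_rate_def
proof (intro exI conjI allI)
  show "0 \<le> C + 1 + \<bar>l\<bar>" using \<open>C \<ge> 0\<close> by simp
  fix N :: nat
  show "\<bar>thue_morse_corr_sum m N - l * N\<bar> \<le> (C + 1 + \<bar>l\<bar>) * sqrt N"
  proof (cases "N = 0")
    case False
    define M where "M = N div 2"
    have "real N = 2 * real M \<or> real N = 2 * real M + 1"
      unfolding M_def by (cases "even N") (auto elim!: evenE oddE)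
    then have *: "\<bar>l * N - l * (2 * real M)\<bar> \<le> \<bar>l\<bar>"
      by (auto simp: algebra_simps)
    have "\<bar>thue_morse_corr_sum m N - thue_morse_corr_sum m (2 * M)\<bar> \<le> 1"
      unfolding M_def by (rule corr_sum_div2)
    then have "\<bar>thue_morse_corr_sum m N - l * N\<bar> \<le> C * sqrt M + 1 + \<bar>l\<bar>"
      using C[of M] * by linarith
    also have "C * sqrt M \<le> C * sqrt N"
      using \<open>C \<ge> 0\<close> by (intro mult_left_mono) (auto simp: M_def)
    also have "C * sqrt N + 1 + \<bar>l\<bar> \<le> (C + 1 + \<bar>l\<bar>) * sqrt N"
    proof -
      have "(1 + \<bar>l\<bar>) * 1 \<le> (1 + \<bar>l\<bar>) * sqrt N"
        using False by (intro mult_left_mono) auto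
      then show ?thesis by (simp add: algebra_simps)
    qed
    finally show ?thesis by simp
  qed (simp add: thue_morse_corr_sum_def)
qed

lemma corr_rate_0: "corr_rate 0 1"
  unfolding corr_rate_def by (intro exI[of _ 0]) (simp add: corr_sum_0)

lemma corr_rate_1: "corr_rate 1 (- 1 / 3)"
proof -
  have "\<bar>thue_morse_corr_sum 1 N + N / 3\<bar> \<le> 5 * sqrt N" for N
  proof (induction N rule: less_induct)
    case (less N)
    show ?case
    proof (cases "N = 0")
      case False
      define M where "M = N div 2"
      have N: "real N = 2 * real M \<or> real N = 2 * real M + 1"
        unfolding M_def by (cases "even N") (auto elim!: evenE oddE)
      have "\<bar>thue_morse_corr_sum 1 N - thue_morse_corr_sum 1 (2 * M)\<bar> \<le> 1"
        unfolding M_def by (rule corr_sum_div2)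
      moreover have "thue_morse_corr_sum 1 (2 * M) = - (real M + thue_morse_corr_sum 1 M)"
        using corr_sum_double_odd[of 0 M] by (simp add: corr_sum_0)
      moreover have "\<bar>thue_morse_corr_sum 1 M + M / 3\<bar> \<le> 5 * sqrt M"
        using False by (intro less) (simp add: M_def)
      ultimately have "\<bar>thue_morse_corr_sum 1 N + N / 3\<bar> \<le> 5 * sqrt M + 4 / 3"
        using N by linarith
      also have "sqrt M \<le> 5 / 7 * sqrt N"
        by (rule real_le_lsqrt) (use N in \<open>auto simp: power2_eq_square\<close>)
      also have "5 * (5 / 7 * sqrt N) + 4 / 3 \<le> 5 * sqrt N"
      proof -
        have "sqrt N \<ge> 1" using False by simp
        then show ?thesis by linarith
      qed
      finally show ?thesis by simp
    qed (simp add: thue_morse_corr_sum_def)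
  qed
  then show ?thesis
    unfolding corr_rate_def by (intro exI[of _ 5]) simp
qed

lemma corr_rate_even:
  assumes "corr_rate m l"
  shows "corr_rate (2 * m) l"
proof -
  obtain C where "C \<ge> 0" and C: "\<And>N. \<bar>thue_morse_corr_sum m N - l * N\<bar> \<le> C * sqrt N"
    using assms unfolding corr_rate_def by blast
  show ?thesis
  proof (rule corr_rate_from_even)
    show "0 \<le> 2 * C" using \<open>C \<ge> 0\<close> by simp
    show "\<bar>thue_morse_corr_sum (2 * m) (2 * M) - l * (2 * real M)\<bar> \<le> 2 * C * sqrt M" for M
      using C[of M] by (simp add: corr_sum_double_even)
  qed
qed

lemma corr_rate_odd:
  assumes "corr_rate m l" "corr_rate (m + 1) l'"
  shows "corr_rate (2 * m + 1) (- (1 / 2) * (l + l'))"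
proof -
  obtain C where "C \<ge> 0" and C: "\<And>N. \<bar>thue_morse_corr_sum m N - l * N\<bar> \<le> C * sqrt N"
    using assms(1) unfolding corr_rate_def by blast
  obtain D where "D \<ge> 0" and D: "\<And>N. \<bar>thue_morse_corr_sum (m + 1) N - l' * N\<bar> \<le> D * sqrt N"
    using assms(2) unfolding corr_rate_def by blast
  show ?thesis
  proof (rule corr_rate_from_even)
    show "0 \<le> C + D" using \<open>C \<ge> 0\<close> \<open>D \<ge> 0\<close> by simp
    show "\<bar>thue_morse_corr_sum (2 * m + 1) (2 * M) - - (1 / 2) * (l + l') * (2 * real M)\<bar>
            \<le> (C + D) * sqrt M" for M
    proof -
      have "- (1 / 2) * (l + l') * (2 * real M) = - (l * real M + l' * real M)"
        by (simp add: field_simps)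
      then show ?thesis
        unfolding corr_sum_double_odd distrib_right using C[of M] D[of M] by linarith
    qed
  qed
qed

lemma ex_corr_rate: "\<exists>l. corr_rate m l"
proof (induction m rule: less_induct)
  case (less m)
  consider "m = 0" | "m = 1" | k where "m = 2 * k" "k > 0" | k where "m = 2 * k + 1" "k > 0"
    by (metis One_nat_def Suc_eq_plus1 evenE gr0I mult_0_right oddE add_0)
  then show ?case
  proof cases
    case 3
    then show ?thesis using less[of k] corr_rate_even by auto
  next
    case 4
    then show ?thesis using less[of k] less[of "k + 1"] corr_rate_odd by fastforce
  qed (use corr_rate_0 corr_rate_1 in auto)
qed

lemma corr_rate_imp_tendsto:
  assumes "corr_rate m l"
  shows "(\<lambda>N. thue_morse_corr_sum m N / real N) \<longlonglongrightarrow> l"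
proof -
  obtain C where "C \<ge> 0" and C: "\<And>N. \<bar>thue_morse_corr_sum m N - l * N\<bar> \<le> C * sqrt N"
    using assms unfolding corr_rate_def by blast
  have "\<bar>thue_morse_corr_sum m N / N - l\<bar> \<le> C * (1 / sqrt N)" if "N > 0" for N :: nat
  proof -
    have "\<bar>thue_morse_corr_sum m N / N - l\<bar> = \<bar>thue_morse_corr_sum m N - l * N\<bar> / N"
      using that by (simp add: field_simps abs_divide flip: abs_mult)
    also have "\<dots> \<le> C * sqrt N / N"
      using C[of N] by (intro divide_right_mono) auto
    also have "\<dots> = C * (1 / sqrt N)"
      using that by (simp add: field_simps)
    finally show ?thesis .
  qed
  then have *: "\<forall>\<^sub>F N in sequentially.
      norm (thue_morse_corr_sum m N / real N - l) \<le> norm (inverse (sqrt (real N))) * C"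
    by (intro eventually_mono[OF eventually_gt_at_top[of 0]]) (simp add: field_simps)
  have "(\<lambda>N. inverse (sqrt (real N))) \<longlonglongrightarrow> 0"
    by (rule tendsto_inverse_0_at_top
          [OF filterlim_compose[OF sqrt_at_top filterlim_real_sequentially]])
  from tendsto_0_le[OF this *] show ?thesis
    by (rule LIM_zero_cancel)
qed

lemma eta_eqI: "corr_rate m l \<Longrightarrow> eta m = l"
  unfolding eta_def by (intro limI corr_rate_imp_tendsto)

lemma corr_rate_eta: "corr_rate m (eta m)"
  using ex_corr_rate[of m] eta_eqI by metis

lemma eta_tendsto: "(\<lambda>N. thue_morse_corr_sum m N / real N) \<longlonglongrightarrow> eta m"
  by (rule corr_rate_imp_tendsto[OF corr_rate_eta])

lemma eta_0: "eta 0 = 1"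
  by (rule eta_eqI[OF corr_rate_0])

lemma eta_even: "eta (2 * m) = eta m"
  by (rule eta_eqI[OF corr_rate_even[OF corr_rate_eta]])

lemma eta_odd: "eta (2 * m + 1) = - (1 / 2) * (eta m + eta (m + 1))"
  by (rule eta_eqI[OF corr_rate_odd[OF corr_rate_eta corr_rate_eta]])

end

(* By the recursion, the pair (eta (2m), eta (2m+1)) and the pair (eta (2m+1), eta (2m+2)) are
   linear images of (eta m, eta (m+1)).  So the sum of |eta m| + |eta (m+1)| over a dyadic block is
   S k (a, b), where S (k+1) (a, b) = S k (a, c) + S k (c, b) with c = -(a+b)/2, evaluated at the
   starting pair.  Each S k is a seminorm.  Convexity bounds its values at the finitely many
   vectors (1,0), (1,-1/3), (1,-1), (1,1) by its predecessor at the same vectors, which gives a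
   growth rate of at most 25/16 < 2^0.6464616661.  For the lower bound, the larger of two linear
   forms is a potential on the pairs of opposite sign that grows by a factor of at least
   17/11 > 2^0.6274882485 per step. *)

theory Submission
  imports Defs
begin

fun descent_sum :: "nat \<Rightarrow> real \<Rightarrow> real \<Rightarrow> real" where
  "descent_sum 0 a b = \<bar>a\<bar> + \<bar>b\<bar>"
| "descent_sum (Suc k) a b = descent_sum k a (- (a + b) / 2) + descent_sum k (- (a + b) / 2) b"

text \<open>The children of the pair at \<open>j\<close> are the pairs at \<open>2 * j\<close> and
  \<open>Suc (2 * j)\<close>, so their blocks concatenate to the doubled block of \<open>j\<close>.
  Interior values of a block are counted twice.\<close>

lemma descent_sum_eta:
  "descent_sum k (eta j) (eta (Suc j)) =
     (\<Sum>m = j * 2 ^ k..<Suc j * 2 ^ k. \<bar>eta m\<bar> + \<bar>eta (Suc m)\<bar>)"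
proof (induction k arbitrary: j)
  case (Suc k)
  have e: "- (eta j + eta (Suc j)) / 2 = eta (Suc (2 * j))"
    "eta j = eta (2 * j)" "eta (Suc j) = eta (Suc (Suc (2 * j)))"
    using eta_odd[of j] eta_even[of j] eta_even[of "Suc j"] by (simp_all add: field_simps)
  have "descent_sum (Suc k) (eta j) (eta (Suc j)) =
      descent_sum k (eta (2 * j)) (eta (Suc (2 * j))) +
      descent_sum k (eta (Suc (2 * j))) (eta (Suc (Suc (2 * j))))"
    by (simp only: descent_sum.simps e(1)) (simp only: e(2,3))
  also have "\<dots> = (\<Sum>m = 2 * j * 2 ^ k..<Suc (Suc (2 * j)) * 2 ^ k. \<bar>eta m\<bar> + \<bar>eta (Suc m)\<bar>)"
    unfolding Suc.IH by (rule sum.atLeastLessThan_concat) simp_all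
  finally show ?case by (simp add: algebra_simps)
qed simp

lemma descent_sum_eta_0:
  "descent_sum k 1 (- 1 / 3) = (\<Sum>m<2 ^ k. \<bar>eta m\<bar> + \<bar>eta (Suc m)\<bar>)"
proof -
  \<comment> \<open>At 0 the recursion has \<open>eta 1\<close> on both sides and is solved for
    it.\<close>
  have "eta 1 = - 1 / 3"
    using eta_odd[of 0] by (simp add: eta_0 field_simps)
  then show ?thesis
    using descent_sum_eta[of k 0] by (simp add: eta_0 atLeast0LessThan)
qed

text \<open>Triangle inequality and homogeneity in one. The induction goes through because both
  children depend linearly on the pair.\<close>

lemma descent_sum_convex:
  "descent_sum k (s * a + t * c) (s * b + t * d) \<le>
     \<bar>s\<bar> * descent_sum k a b + \<bar>t\<bar> * descent_sum k c d"
proof (induction k arbitrary: a b c d)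
  case 0
  have "\<bar>s * a + t * c\<bar> \<le> \<bar>s\<bar> * \<bar>a\<bar> + \<bar>t\<bar> * \<bar>c\<bar>" "\<bar>s * b + t * d\<bar> \<le> \<bar>s\<bar> * \<bar>b\<bar> + \<bar>t\<bar> * \<bar>d\<bar>"
    using abs_triangle_ineq by (simp_all flip: abs_mult)
  then show ?case by (simp add: algebra_simps)
next
  case (Suc k)
  have "- (s * a + t * c + (s * b + t * d)) / 2 = s * (- (a + b) / 2) + t * (- (c + d) / 2)"
    by (simp add: field_simps)
  then show ?case
    using Suc[of a c "- (a + b) / 2" "- (c + d) / 2"] Suc[of "- (a + b) / 2" "- (c + d) / 2" b d]
    by (simp only: descent_sum.simps distrib_left)
qed

lemma descent_sum_scale_le: "descent_sum k (s * a) (s * b) \<le> \<bar>s\<bar> * descent_sum k a b"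
  using descent_sum_convex[of k s a 0 0 b 0] by simp

lemma descent_sum_minus: "descent_sum k (- a) (- b) = descent_sum k a b"
  using descent_sum_scale_le[of k "- 1" a b] descent_sum_scale_le[of k "- 1" "- a" "- b"] by simp

lemma descent_sum_swap: "descent_sum k a b = descent_sum k b a"
  by (induction k arbitrary: a b) (simp_all add: add.commute)

text \<open>Up to sign, order and scaling, every child of the four vectors is one of the four again,
  except (1, -1/2). The weights absorb one step at rate 25/16: 155.5 <= 156.25, 200 <= 200, 256 <=
  256.25 and 98 + 164/3 <= 153.125.\<close>

lemma descent_sum_upper:
  "descent_sum k 1 0 \<le> 100 * (25 / 16) ^ k \<and> descent_sum k 1 (- 1) \<le> 128 * (25 / 16) ^ k \<and>
   descent_sum k 1 1 \<le> 164 * (25 / 16) ^ k \<and> descent_sum k 1 (- 1 / 3) \<le> 98 * (25 / 16) ^ k"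
proof (induction k)
  case (Suc k)
  define q :: real where "q = (25 / 16) ^ k"
  \<comment> \<open>The exceptional child is a convex combination of two listed vectors.\<close>
  have "descent_sum k 1 (- 1 / 2) \<le> 3 / 4 * descent_sum k 1 (- 1 / 3) + 1 / 4 * descent_sum k 1 (- 1)"
    using descent_sum_convex[of k "3 / 4" 1 "1 / 4" 1 "- 1 / 3" "- 1"] by simp
  moreover have "descent_sum k (- 1 / 2) 0 \<le> 1 / 2 * descent_sum k 1 0"
    using descent_sum_scale_le[of k "- 1 / 2" 1 0] by simp
  moreover have "descent_sum k 0 (- 1) = descent_sum k 1 0"
    using descent_sum_minus[of k 0 1] descent_sum_swap[of k 0 1] by simp
  moreover have "descent_sum k (- 1) 1 = descent_sum k 1 (- 1)"
    by (rule descent_sum_swap)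
  moreover have "descent_sum k (- 1 / 3) (- 1 / 3) \<le> 1 / 3 * descent_sum k 1 1"
    using descent_sum_scale_le[of k "- 1 / 3" 1 1] by simp
  moreover have "q \<ge> 0" by (simp add: q_def)
  ultimately show ?case using Suc.IH by (simp flip: q_def)
qed simp

text \<open>Two descents from a pair of opposite signs. The middle child has equal signs, and its
  children have opposite signs again.\<close>

lemma descent_sum_two_steps:
  fixes x y :: real
  shows "descent_sum (Suc (Suc k)) x (- y) =
     descent_sum (Suc k) x (- ((x - y) / 2)) +
     descent_sum k ((x - y) / 2) (- ((x + y) / 4)) + descent_sum k ((x + y) / 4) (- y)"
proof -
  have e: "- (x + - y) / 2 = - ((x - y) / 2)"
    by (simp add: field_simps)
  have "descent_sum (Suc k) (- ((x - y) / 2)) (- y) = descent_sum (Suc k) ((x - y) / 2) y"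
    by (rule descent_sum_minus)
  also have "\<dots> = descent_sum k ((x - y) / 2) (- ((x + y) / 4)) + descent_sum k (- ((x + y) / 4)) y"
    by (simp add: field_simps)
  also have "descent_sum k (- ((x + y) / 4)) y = descent_sum k ((x + y) / 4) (- y)"
    using descent_sum_minus[of k "(x + y) / 4" "- y"] by simp
  finally show ?thesis
    unfolding descent_sum.simps(2)[of "Suc k" x] e by simp
qed

text \<open>The potential max(15 x, 13 x + 6 y) is written as two bounds to keep all goals linear.
  Its forms cross at x = 3 y, and 19 = 13 + 6 is its maximum for x = 1. Two-step induction matches
  \<open>descent_sum_two_steps\<close>.\<close>

lemma descent_sum_lower:
  assumes "0 \<le> y" "y \<le> x"
  shows "(17 / 11) ^ k * (15 * x) \<le> 19 * descent_sum k x (- y) \<and>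
         (17 / 11) ^ k * (13 * x + 6 * y) \<le> 19 * descent_sum k x (- y)"
  using assms
proof (induction k arbitrary: x y rule: induct_nat_012)
  case 0
  then show ?case by simp
next
  case 1
  \<comment> \<open>Here \<open>descent_sum\<close> is exactly 2 x.\<close>
  then show ?case by (simp add: field_simps abs_if)
next
  case (ge2 k)
  define q :: real where "q = (17 / 11) ^ k"
  have q: "q \<ge> 0" by (simp add: q_def)
  have pow: "(17 / 11) ^ Suc k = 17 / 11 * q" "(17 / 11) ^ Suc (Suc k) = 289 / 121 * q"
    by (simp_all add: q_def)
  \<comment> \<open>With q * x and q * y as atoms, the final estimate is linear.\<close>
  have xy: "0 \<le> q * y" "q * y \<le> q * x"
    using q ge2.prems by (auto intro: mult_left_mono)
  have first: "17 / 11 * q * (15 * x) \<le> 19 * descent_sum (Suc k) x (- ((x - y) / 2))"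
    "17 / 11 * q * (13 * x + 6 * ((x - y) / 2)) \<le> 19 * descent_sum (Suc k) x (- ((x - y) / 2))"
    using ge2.IH(2)[of "(x - y) / 2" x] ge2.prems unfolding pow by simp_all
  \<comment> \<open>The sign of x - 3 y decides which entry is larger in absolute value in both
    grandchildren.\<close>
  show ?case
  proof (cases "3 * y \<le> x")
    case True
    have "q * (3 * y) \<le> q * x"
      using q True by (intro mult_left_mono)
    moreover have
      "q * (15 * ((x - y) / 2)) \<le> 19 * descent_sum k ((x - y) / 2) (- ((x + y) / 4))"
      "q * (13 * ((x - y) / 2) + 6 * ((x + y) / 4)) \<le>
         19 * descent_sum k ((x - y) / 2) (- ((x + y) / 4))"
      using ge2.IH(1)[of "(x + y) / 4" "(x - y) / 2"] ge2.prems True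
      unfolding q_def by simp_all
    moreover have
      "q * (15 * ((x + y) / 4)) \<le> 19 * descent_sum k ((x + y) / 4) (- y)"
      "q * (13 * ((x + y) / 4) + 6 * y) \<le> 19 * descent_sum k ((x + y) / 4) (- y)"
      using ge2.IH(1)[of y "(x + y) / 4"] ge2.prems True
      unfolding q_def by simp_all
    ultimately show ?thesis
      using first xy unfolding pow descent_sum_two_steps by (simp add: field_simps del: descent_sum.simps)
  next
    case False
    \<comment> \<open>Now the second entry dominates; swapping restores the order required by the
      induction hypothesis.\<close>
    have flip: "descent_sum k a (- b) = descent_sum k b (- a)" for a b
      using descent_sum_minus[of k a "- b"] descent_sum_swap[of k "- a" b] by simp
    have "q * x \<le> q * (3 * y)"
      using q False by (intro mult_left_mono) simp_all
    moreover have
      "q * (15 * ((x + y) / 4)) \<le> 19 * descent_sum k ((x - y) / 2) (- ((x + y) / 4))"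
      "q * (13 * ((x + y) / 4) + 6 * ((x - y) / 2)) \<le>
         19 * descent_sum k ((x - y) / 2) (- ((x + y) / 4))"
      using ge2.IH(1)[of "(x - y) / 2" "(x + y) / 4"] ge2.prems False
      unfolding q_def flip[of "(x - y) / 2"] by simp_all
    moreover have
      "q * (15 * y) \<le> 19 * descent_sum k ((x + y) / 4) (- y)"
      "q * (13 * y + 6 * ((x + y) / 4)) \<le> 19 * descent_sum k ((x + y) / 4) (- y)"
      using ge2.IH(1)[of "(x + y) / 4" y] ge2.prems False
      unfolding q_def flip[of "(x + y) / 4"] by simp_all
    ultimately show ?thesis
      using first xy unfolding pow descent_sum_two_steps by (simp add: field_simps del: descent_sum.simps)
  qed
qed

text \<open>Reduces a rational exponent to a computation with integer powers.\<close>

lemma two_powr_le_iff_power: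
  fixes r :: real
  assumes "r > 0" "q > 0"
  shows "2 powr (real p / real q) \<le> r \<longleftrightarrow> 2 ^ p \<le> r ^ q"
    and "r \<le> 2 powr (real p / real q) \<longleftrightarrow> r ^ q \<le> 2 ^ p"
proof -
  have "(2 powr (real p / real q)) ^ q = (2 :: real) ^ p"
    using assms by (simp add: powr_powr powr_realpow flip: powr_realpow)
  then show "2 powr (real p / real q) \<le> r \<longleftrightarrow> 2 ^ p \<le> r ^ q"
    "r \<le> 2 powr (real p / real q) \<longleftrightarrow> r ^ q \<le> 2 ^ p"
    using assms power_mono_iff[of "2 powr (real p / real q)" r q]
      power_mono_iff[of r "2 powr (real p / real q)" q] by simp_all
qed

lemma two_powr_lower_exponent: "2 powr 0.6274882485 \<le> (17 / 11 :: real)"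
proof -
  \<comment> \<open>27/43 = 0.6279... lies between the exponent and log2(17/11) = 0.6280...\<close>
  have "2 powr 0.6274882485 \<le> (2 :: real) powr (real 27 / real 43)"
    by (intro powr_mono) simp_all
  also have "\<dots> \<le> 17 / 11"
    by (subst two_powr_le_iff_power) (simp_all add: field_simps)
  finally show ?thesis .
qed

lemma two_powr_upper_exponent: "25 / 16 \<le> (2 :: real) powr 0.6464616661"
proof -
  \<comment> \<open>20/31 = 0.6451... lies between log2(25/16) = 0.6438... and the exponent.\<close>
  have "25 / 16 \<le> (2 :: real) powr (real 20 / real 31)"
    by (subst two_powr_le_iff_power) (simp_all add: field_simps)
  also have "\<dots> \<le> (2 :: real) powr 0.6464616661"
    by (intro powr_mono) simp_all
  finally show ?thesis .
qed

lemma ex_dyadic_scale: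
  fixes x :: real
  assumes "x \<ge> 1"
  obtains k where "2 ^ k \<le> x" "x < 2 ^ Suc k"
proof -
  have "1 \<le> nat \<lfloor>x\<rfloor>" using assms by linarith
  then obtain k where k: "2 ^ k \<le> nat \<lfloor>x\<rfloor>" "nat \<lfloor>x\<rfloor> < 2 ^ (k + 1)"
    using ex_power_ivl1[of 2 "nat \<lfloor>x\<rfloor>"] by auto
  then have "real (2 ^ k) \<le> x" "x < real (2 ^ (k + 1))"
    using assms by linarith+
  then show thesis using that[of k] by simp
qed

theorem theorem1p1:
  "\<exists>c1 c2 :: real. c1 > 0 \<and> c2 > 0 \<and>
     (\<forall>x :: real. x \<ge> 1 \<longrightarrow>
        c1 * x powr 0.6274882485 \<le> (\<Sum>m | real m \<le> x. \<bar>eta m\<bar>) \<and>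
        (\<Sum>m | real m \<le> x. \<bar>eta m\<bar>) \<le> c2 * x powr 0.6464616661)"
proof (intro exI conjI allI impI)
  \<comment> \<open>15/76 is 15/19 halved twice: once for x < 2 * 2^k, once for the double counting.
    The factor 25/16 pays for covering x by the block of length 2^(k+1).\<close>
  show "(15 / 76 :: real) > 0" "(98 * (25 / 16) :: real) > 0" by simp_all
  fix x :: real
  assume "x \<ge> 1"
  then obtain k where k: "2 ^ k \<le> x" "x < 2 ^ Suc k"
    by (rule ex_dyadic_scale)
  have pow_k: "((2 :: real) ^ k) powr e = (2 powr e) ^ k" for e
    by (simp add: powr_powr mult.commute flip: powr_realpow)
  have "m < 2 ^ Suc k" if "real m \<le> x" for m
  proof -
    have "real m < real (2 ^ Suc k)" using that k by simp
    then show ?thesis by (simp only: of_nat_less_iff)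
  qed
  then have sub: "{m. real m \<le> x} \<subseteq> {..<2 ^ Suc k}"
    by blast
  then have fin: "finite {m. real m \<le> x}"
    by (rule finite_subset) simp

  have "x powr 0.6274882485 \<le> (2 * 2 ^ k) powr 0.6274882485"
    using k \<open>x \<ge> 1\<close> by (intro powr_mono2) simp_all
  also have "\<dots> = 2 powr 0.6274882485 * (2 powr 0.6274882485) ^ k"
    by (simp add: powr_mult pow_k)
  also have "\<dots> \<le> 2 * (17 / 11) ^ k"
    using two_powr_lower_exponent by (intro mult_mono power_mono) simp_all
  finally have "15 / 76 * x powr 0.6274882485 \<le> 15 / 38 * (17 / 11) ^ k"
    by simp
  also have "\<dots> \<le> descent_sum k 1 (- 1 / 3) / 2"
    using descent_sum_lower[of "1 / 3" 1 k] by simp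
  \<comment> \<open>Both index sets lie in [0, 2^k], so each sum is at most the target.\<close>
  also have "\<dots> = ((\<Sum>m<2 ^ k. \<bar>eta m\<bar>) + (\<Sum>m\<in>Suc ` {..<2 ^ k}. \<bar>eta m\<bar>)) / 2"
    unfolding descent_sum_eta_0 by (simp add: sum.distrib sum.reindex)
  also have "\<dots> \<le> (\<Sum>m | real m \<le> x. \<bar>eta m\<bar>)"
  proof -
    have "real m \<le> x" if "m \<le> 2 ^ k" for m
    proof -
      have "real m \<le> real (2 ^ k)" using that by (rule of_nat_mono)
      also have "real (2 ^ k) \<le> x" using k by simp
      finally show ?thesis .
    qed
    then have "{..<2 ^ k} \<subseteq> {m. real m \<le> x}" "Suc ` {..<2 ^ k} \<subseteq> {m. real m \<le> x}"
      by (auto simp del: of_nat_Suc)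
    from this[THEN sum_mono2[OF fin, where f = "\<lambda>m. \<bar>eta m\<bar>"]] show ?thesis
      by simp
  qed
  finally show "15 / 76 * x powr 0.6274882485 \<le> (\<Sum>m | real m \<le> x. \<bar>eta m\<bar>)" .

  have "(\<Sum>m | real m \<le> x. \<bar>eta m\<bar>) \<le> (\<Sum>m<2 ^ Suc k. \<bar>eta m\<bar>)"
    using sub by (intro sum_mono2) auto
  also have "\<dots> \<le> descent_sum (Suc k) 1 (- 1 / 3)"
    unfolding descent_sum_eta_0 by (intro sum_mono) simp
  also have "\<dots> \<le> 98 * (25 / 16) ^ Suc k"
    using descent_sum_upper by blast
  also have "\<dots> \<le> 98 * (25 / 16) * (2 ^ k) powr 0.6464616661"
    using two_powr_upper_exponent by (simp add: pow_k power_mono)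
  also have "\<dots> \<le> 98 * (25 / 16) * x powr 0.6464616661"
    using k by (intro mult_left_mono powr_mono2) simp_all
  finally show "(\<Sum>m | real m \<le> x. \<bar>eta m\<bar>) \<le> 98 * (25 / 16) * x powr 0.6464616661" .
qed

end
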